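(* Let $(X,d)$ and $(Y,\mu)$ be metric spaces, let $\mathcal B$ be a bornology on $X$, let $\mathcal I$ be a $\mathcal G$-admissible ideal of a directed set $(\mathcal G,\geq)$, let $\{(D_\gamma,u_\gamma)\}_{\gamma\in\mathcal G}$ be a net in $\mathcal P[X,Y]$ and let $(D,u)\in\mathcal P[X,Y]$. If $\{(D_\gamma,u_\gamma)\}_{\gamma\in\mathcal G}$ is $\mathcal P_{\mathcal I^*}(\mathcal B)$-convergent to $(D,u)$, then it is $\mathcal P_{\mathcal I}(\mathcal B)$-convergent to $(D,u)$.
   Context: $\mathcal P[X,Y]$ is the set of partial maps from $X$ to $Y$: pairs $(F,v)$ with $F$ a non-empty closed subset of $X$ and $v:F\to Y$ a function (not necessarily continuous). A bornology on $X$ is a family $\mathcal B$ of non-empty subsets of $X$ that covers $X$, is closed under finite unions, and contains every non-empty subset of each of its members. In a metric space, for a subset $G$ and $\epsilon>0$, $G^\epsilon$ is the union of the open $\epsilon$-balls centered at points of $G$ (so $\emptyset^\epsilon=\emptyset$). An ideal of a set $\mathcal G$ is a family $\mathcal I\subset 2^{\mathcal G}$ containing $\emptyset$, closed under finite unions and under taking subsets; it is non-trivial if $\mathcal I\neq\{\emptyset\}$ and $\mathcal G\notin\mathcal I$. For a non-trivial ideal, $\mathcal F(\mathcal I)=\{A\subset\mathcal G:\mathcal G\setminus A\in\mathcal I\}$ is the associated filter. For a directed set $(\mathcal G,\geq)$ and $\gamma\in\mathcal G$ put $\mathcal M_\gamma=\{\alpha\in\mathcal G:\alpha\geq\gamma\}$.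 A non-trivial ideal $\mathcal I$ of $\mathcal G$ is $\mathcal G$-admissible if $\mathcal M_\gamma\in\mathcal F(\mathcal I)$ for all $\gamma\in\mathcal G$. For $B\in\mathcal B$ and $\epsilon>0$ consider, for an index $\gamma$, the two conditions: (L) $u(D\cap B_1)\subset[u_\gamma(D_\gamma\cap B_1^\epsilon)]^\epsilon$ for all $B_1\subset B$; (U) $u_\gamma(D_\gamma\cap B_1)\subset[u(D\cap B_1^\epsilon)]^\epsilon$ for all $B_1\subset B$. A net $\{(D_\gamma,u_\gamma)\}_{\gamma\in\mathcal G'}$ over a directed set $\mathcal G'$ is $\mathcal P(\mathcal B)$-convergent to $(D,u)$ if for every $B\in\mathcal B$ and $\epsilon>0$ there is $\gamma_0\in\mathcal G'$ such that (L) and (U) hold for all $\gamma\in\mathcal G'$ with $\gamma\geq\gamma_0$. The net $\{(D_\gamma,u_\gamma)\}_{\gamma\in\mathcal G}$ is $\mathcal P_{\mathcal I}(\mathcal B)$-convergent to $(D,u)$ if for every $B\in\mathcal B$ and $\epsilon>0$ both the set of $\gamma\in\mathcal G$ satisfying (L) and the set of $\gamma\in\mathcal G$ satisfying (U) belong to $\mathcal F(\mathcal I)$. The net $\{(D_\gamma,u_\gamma)\}_{\gamma\in\mathcal G}$ is $\mathcal P_{\mathcal I^*}(\mathcal B)$-convergent to $(D,u)$ if there is a set $\mathcal G'\in\mathcal F(\mathcal I)$ such that $\mathcal G'$ is itself a directed set with respect to the relation induced from $(\mathcal G,\geq)$ and the net $\{(D_\gamma,u_\gamma)\}_{\gamma\in\mathcal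 G'}$ is $\mathcal P(\mathcal B)$-convergent to $(D,u)$. *)

theory Defs
  imports "HOL-Analysis.Analysis"
begin

section \<open>Directed sets, ideals and filters\<close>

text \<open>A directed set is a carrier \<open>G\<close> with a relation \<open>geq\<close> that is only constrained on \<open>G\<close>.
  A subset of \<open>G\<close> with the induced relation is thus obtained by changing the carrier alone.
  Antisymmetry is not required.\<close>

definition directed_set :: "'g set \<Rightarrow> ('g \<Rightarrow> 'g \<Rightarrow> bool) \<Rightarrow> bool" where
  "directed_set G geq \<longleftrightarrow> G \<noteq> {} \<and> reflp_on G geq \<and> transp_on G geq \<and>
     (\<forall>\<alpha>\<in>G. \<forall>\<beta>\<in>G. \<exists>\<gamma>\<in>G. geq \<gamma> \<alpha> \<and> geq \<gamma> \<beta>)"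

definition ideal_on :: "'g set \<Rightarrow> 'g set set \<Rightarrow> bool" where
  "ideal_on G I \<longleftrightarrow> I \<subseteq> Pow G \<and> {} \<in> I \<and>
     (\<forall>\<A>. finite \<A> \<and> \<A> \<noteq> {} \<and> \<A> \<subseteq> I \<longrightarrow> \<Union>\<A> \<in> I) \<and>
     (\<forall>A\<in>I. \<forall>A'. A' \<subseteq> A \<longrightarrow> A' \<in> I)"

definition nontrivial_ideal_on :: "'g set \<Rightarrow> 'g set set \<Rightarrow> bool" where
  "nontrivial_ideal_on G I \<longleftrightarrow> ideal_on G I \<and> I \<noteq> {{}} \<and> G \<notin> I"

definition assoc_filter :: "'g set \<Rightarrow> 'g set set \<Rightarrow> 'g set set" where
  "assoc_filter G I = {A. A \<subseteq> G \<and> G - A \<in> I}"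

definition tail_set :: "'g set \<Rightarrow> ('g \<Rightarrow> 'g \<Rightarrow> bool) \<Rightarrow> 'g \<Rightarrow> 'g set" where
  "tail_set G geq \<gamma> = {\<alpha>\<in>G. geq \<alpha> \<gamma>}"

definition admissible_ideal :: "'g set \<Rightarrow> ('g \<Rightarrow> 'g \<Rightarrow> bool) \<Rightarrow> 'g set set \<Rightarrow> bool" where
  "admissible_ideal G geq I \<longleftrightarrow> nontrivial_ideal_on G I \<and>
     (\<forall>\<gamma>\<in>G. tail_set G geq \<gamma> \<in> assoc_filter G I)"

section \<open>Partial maps and bornologies\<close>

text \<open>A function defined on \<open>F\<close> only is represented by the total function that is
  \<open>undefined\<close> outside \<open>F\<close>.\<close>

definition partial_maps :: "('a::metric_space set \<times> ('a \<Rightarrow> 'b::metric_space)) set" where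
  "partial_maps = {(F, v). F \<noteq> {} \<and> closed F \<and> v \<in> extensional F}"

definition bornology :: "'a set set \<Rightarrow> bool" where
  "bornology \<B> \<longleftrightarrow> {} \<notin> \<B> \<and> \<Union>\<B> = UNIV \<and>
     (\<forall>\<A>. finite \<A> \<and> \<A> \<noteq> {} \<and> \<A> \<subseteq> \<B> \<longrightarrow> \<Union>\<A> \<in> \<B>) \<and>
     (\<forall>B\<in>\<B>. \<forall>B'. B' \<noteq> {} \<and> B' \<subseteq> B \<longrightarrow> B' \<in> \<B>)"

definition enlargement :: "'a::metric_space set \<Rightarrow> real \<Rightarrow> 'a set" where
  "enlargement S \<epsilon> = (\<Union>x\<in>S. ball x \<epsilon>)"

section \<open>Bornological convergence of nets of partial maps\<close>

text \<open>In both conditions the first partial map, \<open>(D, u)\<close>, is the limit and the second one,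
  \<open>(E, w)\<close>, is a term of the net. The set \<open>B1\<close> may be empty.\<close>

definition lower_cond :: "'a::metric_space set \<times> ('a \<Rightarrow> 'b::metric_space) \<Rightarrow>
    'a set \<times> ('a \<Rightarrow> 'b) \<Rightarrow> 'a set \<Rightarrow> real \<Rightarrow> bool" where
  "lower_cond = (\<lambda>(D, u) (E, w) B \<epsilon>.
     \<forall>B1\<subseteq>B. u ` (D \<inter> B1) \<subseteq> enlargement (w ` (E \<inter> enlargement B1 \<epsilon>)) \<epsilon>)"

definition upper_cond :: "'a::metric_space set \<times> ('a \<Rightarrow> 'b::metric_space) \<Rightarrow>
    'a set \<times> ('a \<Rightarrow> 'b) \<Rightarrow> 'a set \<Rightarrow> real \<Rightarrow> bool" where
  "upper_cond = (\<lambda>(D, u) (E, w) B \<epsilon>.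
     \<forall>B1\<subseteq>B. w ` (E \<inter> B1) \<subseteq> enlargement (u ` (D \<inter> enlargement B1 \<epsilon>)) \<epsilon>)"

definition P_convergent :: "'g set \<Rightarrow> ('g \<Rightarrow> 'g \<Rightarrow> bool) \<Rightarrow> 'a::metric_space set set \<Rightarrow>
    ('g \<Rightarrow> 'a set \<times> ('a \<Rightarrow> 'b::metric_space)) \<Rightarrow> 'a set \<times> ('a \<Rightarrow> 'b) \<Rightarrow> bool" where
  "P_convergent G geq \<B> N L \<longleftrightarrow> (\<forall>B\<in>\<B>. \<forall>\<epsilon>>0. \<exists>\<gamma>0\<in>G. \<forall>\<gamma>\<in>G. geq \<gamma> \<gamma>0 \<longrightarrow>
     lower_cond L (N \<gamma>) B \<epsilon> \<and> upper_cond L (N \<gamma>) B \<epsilon>)"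

definition P_I_convergent :: "'g set \<Rightarrow> 'g set set \<Rightarrow> 'a::metric_space set set \<Rightarrow>
    ('g \<Rightarrow> 'a set \<times> ('a \<Rightarrow> 'b::metric_space)) \<Rightarrow> 'a set \<times> ('a \<Rightarrow> 'b) \<Rightarrow> bool" where
  "P_I_convergent G I \<B> N L \<longleftrightarrow> (\<forall>B\<in>\<B>. \<forall>\<epsilon>>0.
     {\<gamma>\<in>G. lower_cond L (N \<gamma>) B \<epsilon>} \<in> assoc_filter G I \<and>
     {\<gamma>\<in>G. upper_cond L (N \<gamma>) B \<epsilon>} \<in> assoc_filter G I)"

definition P_I_star_convergent :: "'g set \<Rightarrow> ('g \<Rightarrow> 'g \<Rightarrow> bool) \<Rightarrow> 'g set set \<Rightarrow>
    'a::metric_space set set \<Rightarrow> ('g \<Rightarrow> 'a set \<times> ('a \<Rightarrow> 'b::metric_space)) \<Rightarrow>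
    'a set \<times> ('a \<Rightarrow> 'b) \<Rightarrow> bool" where
  "P_I_star_convergent G geq I \<B> N L \<longleftrightarrow>
     (\<exists>G'\<in>assoc_filter G I. directed_set G' geq \<and> P_convergent G' geq \<B> N L)"

end

theory Submission
  imports Defs
begin

text \<open>Fix \<open>B\<close> and \<open>\<epsilon>\<close>. Convergence along \<open>G'\<close>
  yields \<open>\<gamma>0\<close> in \<open>G'\<close> such that both conditions hold at every index
  of \<open>G'\<close> above \<open>\<gamma>0\<close>, that is, on the intersection of
  \<open>G'\<close> with the tail of \<open>\<gamma>0\<close> in \<open>G\<close>. \<open>G'\<close>
  lies in the filter by choice and the tail by admissibility, so their intersection does too
  (\<open>assoc_filter_Int\<close>). Each set of good indices contains it and hence lies in the
  filter (\<open>assoc_filter_superset\<close>).\<close>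

lemma assoc_filter_Int:
  assumes "ideal_on G I" "A \<in> assoc_filter G I" "A' \<in> assoc_filter G I"
  shows "A \<inter> A' \<in> assoc_filter G I"
proof -
  \<comment> \<open>By De Morgan, the complement of the intersection is the union of this two-member
    family, to which closure of \<open>I\<close> under finite unions applies.\<close>
  have "finite {G - A, G - A'} \<and> {G - A, G - A'} \<noteq> {} \<and> {G - A, G - A'} \<subseteq> I"
    using assms by (simp add: assoc_filter_def)
  moreover have "\<forall>\<A>. finite \<A> \<and> \<A> \<noteq> {} \<and> \<A> \<subseteq> I \<longrightarrow> \<Union>\<A> \<in> I"
    using assms(1) by (simp add: ideal_on_def)
  ultimately have "\<Union>{G - A, G - A'} \<in> I"
    by (elim allE[where x = "{G - A, G - A'}"] impE)
  then show ?thesis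
    using assms(2) by (auto simp: assoc_filter_def Diff_Int)
qed

text \<open>Complementation in \<open>G\<close> reverses inclusion, so this is downward closure of
  \<open>I\<close> read on complements.\<close>

lemma assoc_filter_superset:
  assumes "ideal_on G I" "A \<in> assoc_filter G I" "A \<subseteq> A'" "A' \<subseteq> G"
  shows "A' \<in> assoc_filter G I"
proof -
  have "G - A \<in> I" "G - A' \<subseteq> G - A"
    using assms by (auto simp: assoc_filter_def)
  moreover have "\<forall>S\<in>I. \<forall>S'. S' \<subseteq> S \<longrightarrow> S' \<in> I"
    using assms(1) by (simp add: ideal_on_def)
  ultimately have "G - A' \<in> I"
    by blast
  then show ?thesis
    using assms(4) by (simp add: assoc_filter_def)
qed

text \<open>The partial maps stay packed in \<open>N\<close> and \<open>L\<close>: the two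
  conditions are never unfolded, and only the index sets on which they hold matter.\<close>

lemma P_I_star_convergent_imp_P_I_convergent:
  assumes "admissible_ideal G geq I" "P_I_star_convergent G geq I \<B> N L"
  shows "P_I_convergent G I \<B> N L"
  unfolding P_I_convergent_def
proof (intro ballI allI impI)
  fix B and \<epsilon> :: real
  assume "B \<in> \<B>" "\<epsilon> > 0"
  have ideal: "ideal_on G I"
    using assms(1) by (simp add: admissible_ideal_def nontrivial_ideal_on_def)
  obtain G' where G': "G' \<in> assoc_filter G I" "P_convergent G' geq \<B> N L"
    using assms(2) by (auto simp: P_I_star_convergent_def)
  then obtain \<gamma>0 where "\<gamma>0 \<in> G'" and conds: "\<And>\<gamma>. \<gamma> \<in> G' \<Longrightarrow> geq \<gamma> \<gamma>0 \<Longrightarrow>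
      lower_cond L (N \<gamma>) B \<epsilon> \<and> upper_cond L (N \<gamma>) B \<epsilon>"
    using \<open>B \<in> \<B>\<close> \<open>\<epsilon> > 0\<close> unfolding P_convergent_def by meson
  \<comment> \<open>Admissibility concerns tails at points of \<open>G\<close>, whereas
    \<open>\<gamma>0\<close> was found in \<open>G'\<close>.\<close>
  have "\<gamma>0 \<in> G"
    using G'(1) \<open>\<gamma>0 \<in> G'\<close> by (auto simp: assoc_filter_def)
  then have tail: "G' \<inter> tail_set G geq \<gamma>0 \<in> assoc_filter G I"
    using assms(1) G'(1) ideal by (simp add: admissible_ideal_def assoc_filter_Int)
  show "{\<gamma>\<in>G. lower_cond L (N \<gamma>) B \<epsilon>} \<in> assoc_filter G I \<and>
        {\<gamma>\<in>G. upper_cond L (N \<gamma>) B \<epsilon>} \<in> assoc_filter G I"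
    \<comment> \<open>The same intersection serves as the smaller set for both memberships;
      \<open>conds\<close> gives the inclusions.\<close>
    using conds by (auto simp: tail_set_def intro!: assoc_filter_superset[OF ideal tail])
qed

theorem theorem4p4:
  fixes \<B> :: "'a::metric_space set set"
    and G :: "'g set" and geq :: "'g \<Rightarrow> 'g \<Rightarrow> bool" and I :: "'g set set"
    and D\<gamma> :: "'g \<Rightarrow> 'a set" and u\<gamma> :: "'g \<Rightarrow> 'a \<Rightarrow> 'b::metric_space"
    and D :: "'a set" and u :: "'a \<Rightarrow> 'b"
  assumes "bornology \<B>"
    and "directed_set G geq"
    and "admissible_ideal G geq I"
    and "\<And>\<gamma>. \<gamma> \<in> G \<Longrightarrow> (D\<gamma> \<gamma>, u\<gamma> \<gamma>) \<in> partial_maps"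
    and "(D, u) \<in> partial_maps"
    and "P_I_star_convergent G geq I \<B> (\<lambda>\<gamma>. (D\<gamma> \<gamma>, u\<gamma> \<gamma>)) (D, u)"
  shows "P_I_convergent G I \<B> (\<lambda>\<gamma>. (D\<gamma> \<gamma>, u\<gamma> \<gamma>)) (D, u)"
  using assms(3,6) by (rule P_I_star_convergent_imp_P_I_convergent)

end
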